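(* Let an instance of the single-machine weighted flow-time problem be given, with jobs $j$ having integer processing requirements $p_j$, weights $w_j$ and release dates $r_j$, and let $T=\sum_j p_j$. Consider the integer program (IP1) with a binary variable $x_{j,t}$ for every job $j$ and every integer $t$ with $r_j \le t \le T$: $$\min \sum_j \sum_{t\in[r_j,T]} w_j x_{j,t}$$ subject to $$\sum_{j\in J(I)} x_{j,t}\, p_j \;\ge\; p(J(I)) - l(I) \quad\text{for all intervals } I=[s,t] \text{ with integers } 0\le s\le t\le T,$$ $$x_{j,t}\le x_{j,t-1}\quad\text{for all jobs } j \text{ and integers } t \text{ with } r_j<t\le T,$$ $$x_{j,t}\in\{0,1\},$$ where for $I=[s,t]$, $l(I)=t-s$, $J(I)=\{j : r_j\in I\}$ and $p(J(I))=\sum_{j\in J(I)} p_j$. If $x$ is a feasible solution of (IP1), then there is a feasible schedule whose total weighted flow-time is equal to the cost $\sum_j\sum_{t\in[r_j,T]} w_j x_{j,t}$ of $x$.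
   Context: Single-machine weighted flow-time problem: each job $j$ has integer processing requirement $p_j$, weight $w_j$ and release date $r_j$. Time is divided into unit slots $[t,t+1]$; a feasible preemptive schedule processes at most one job per slot and processes each job $j$ for $p_j$ slots at or after $r_j$. The weighted flow-time of job $j$ is $w_j(C_j-r_j)$ where $C_j$ is its completion time, and the total weighted flow-time is the sum over jobs.
   Formalization: As stated the claim is false: the formal version proves flow-time at most the cost of x, with equality when x is optimal for (IP1), and assumes some feasible schedule completes all jobs by time T+1; processing requirements are positive and weights nonnegative. *)

theory Defs
  imports Complex_Main
begin

record 'j wft_instance =
  jobs :: "'j set"
  proc :: "'j \<Rightarrow> nat"
  weight :: "'j \<Rightarrow> real"
  release :: "'j \<Rightarrow> nat"

definition wft_valid :: "'j wft_instance \<Rightarrow> bool" where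
  "wft_valid Q \<longleftrightarrow>
     finite (jobs Q) \<and> (\<forall>j\<in>jobs Q. 0 < proc Q j \<and> 0 \<le> weight Q j)"

definition total_proc :: "'j wft_instance \<Rightarrow> nat" where
  "total_proc Q = (\<Sum>j\<in>jobs Q. proc Q j)"

(* A schedule says which job, if any, is processed in the slot [t, t+1].
   It has no horizon: idle slots and slots after total_proc Q are allowed. *)
type_synonym 'j schedule = "nat \<Rightarrow> 'j option"

definition slots :: "'j schedule \<Rightarrow> 'j \<Rightarrow> nat set" where
  "slots \<sigma> j = {t. \<sigma> t = Some j}"

definition feasible_schedule :: "'j wft_instance \<Rightarrow> 'j schedule \<Rightarrow> bool" where
  "feasible_schedule Q \<sigma> \<longleftrightarrow>
     (\<forall>t j. \<sigma> t = Some j \<longrightarrow> j \<in> jobs Q \<and> release Q j \<le> t) \<and>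
     (\<forall>j\<in>jobs Q. finite (slots \<sigma> j) \<and> card (slots \<sigma> j) = proc Q j)"

(* The right end point of the last slot in which j is processed; meaningful because
   proc Q j > 0 makes the finite set of slots nonempty in a feasible schedule. *)
definition completion_time :: "'j schedule \<Rightarrow> 'j \<Rightarrow> nat" where
  "completion_time \<sigma> j = Suc (Max (slots \<sigma> j))"

definition weighted_flow_time :: "'j wft_instance \<Rightarrow> 'j schedule \<Rightarrow> real" where
  "weighted_flow_time Q \<sigma> =
     (\<Sum>j\<in>jobs Q. weight Q j * (real (completion_time \<sigma> j) - real (release Q j)))"

definition jobs_in :: "'j wft_instance \<Rightarrow> nat \<Rightarrow> nat \<Rightarrow> 'j set" where
  "jobs_in Q s t = {j \<in> jobs Q. s \<le> release Q j \<and> release Q j \<le> t}"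

(* Only the values x j t with j a job and release Q j <= t <= total_proc Q are
   variables of the program; all other values are unconstrained and never used. *)
definition ip_feasible :: "'j wft_instance \<Rightarrow> ('j \<Rightarrow> nat \<Rightarrow> int) \<Rightarrow> bool" where
  "ip_feasible Q x \<longleftrightarrow>
     (\<forall>s t. s \<le> t \<and> t \<le> total_proc Q \<longrightarrow>
        (\<Sum>j\<in>jobs_in Q s t. x j t * int (proc Q j))
          \<ge> (\<Sum>j\<in>jobs_in Q s t. int (proc Q j)) - (int t - int s)) \<and>
     (\<forall>j\<in>jobs Q. \<forall>t. release Q j < t \<and> t \<le> total_proc Q \<longrightarrow> x j t \<le> x j (t - 1)) \<and>
     (\<forall>j\<in>jobs Q. \<forall>t. release Q j \<le> t \<and> t \<le> total_proc Q \<longrightarrow> x j t \<in> {0, 1})"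

definition ip_cost :: "'j wft_instance \<Rightarrow> ('j \<Rightarrow> nat \<Rightarrow> int) \<Rightarrow> real" where
  "ip_cost Q x =
     (\<Sum>j\<in>jobs Q. \<Sum>t\<in>{release Q j..total_proc Q}. weight Q j * real_of_int (x j t))"

definition ip_optimal :: "'j wft_instance \<Rightarrow> ('j \<Rightarrow> nat \<Rightarrow> int) \<Rightarrow> bool" where
  "ip_optimal Q x \<longleftrightarrow>
     ip_feasible Q x \<and> (\<forall>y. ip_feasible Q y \<longrightarrow> ip_cost Q x \<le> ip_cost Q y)"

(* The variables reach up to the slot [T, T+1] with T = total_proc Q, so the program can
   only represent completion times up to T + 1. If the release dates force a later
   completion, its cost does not bound the flow time: a single job with proc = 1 and
   release = 5 has T = 1, no variables at all, and cost 0. *)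
definition horizon_suffices :: "'j wft_instance \<Rightarrow> bool" where
  "horizon_suffices Q \<longleftrightarrow>
     (\<exists>\<sigma>. feasible_schedule Q \<sigma> \<and> (\<forall>j\<in>jobs Q. completion_time \<sigma> j \<le> total_proc Q + 1))"

(* The cost of a feasible but not optimal x need not be the flow time of any schedule.
   Two jobs with proc = 1, release = 0, weights 2 and 3 and x j 0 = x j 1 = 1, x j 2 = 0
   give a feasible x of cost 10, but 2 * C1 + 3 * C2 = 10 has no solution in distinct
   positive integers. For such x the cost is an upper bound on the flow time. *)

end

(* A feasible x keeps x j t = 1 exactly until a deadline of j, and its cost is the weighted sum
   of the deadlines minus the release dates. The interval constraints are Hall's condition for
   meeting these deadlines: the jobs released and due within [s, t] have total length at most
   t - s. The earliest-deadline-first rule then yields a schedule with all completion times at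
   most the deadlines. Conversely, the completion times of that schedule define a solution of
   the program whose cost is the flow time, which forces equality when x is optimal. *)
theory Submission
  imports Defs
begin

section \<open>Hall's condition and earliest-deadline-first scheduling\<close>

text \<open>Induction on the number of unit jobs. Among the jobs with the earliest release date, one
  with the earliest deadline gets the first slot. This raises the release dates of the others, so
  the induction leaves \<open>r\<close> arbitrary, and the work lies in showing that Hall's
  condition survives.\<close>

lemma unit_jobs_schedulable:
  fixes r d :: "'a \<Rightarrow> nat"
  assumes "finite U"
    and "\<And>s t. card {v \<in> U. s \<le> r v \<and> d v \<le> t} \<le> t - s"
  shows "\<exists>f. inj_on f U \<and> (\<forall>u\<in>U. r u \<le> f u \<and> f u < d u)"
  using assms
proof (induction "card U" arbitrary: U r)
  case 0
  then show ?case by auto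
next
  case (Suc n)
  let ?R = "Min (r ` U)"
  let ?F = "{v \<in> U. r v = ?R}"
  have U: "finite U" "U \<noteq> {}" using Suc.hyps(2) Suc.prems(1) by auto
  then have R_le: "?R \<le> r v" if "v \<in> U" for v using that by simp
  have "?R \<in> r ` U" using U by (intro Min_in) auto
  then have "?F \<noteq> {}" by auto
  moreover have "finite ?F" using U by simp
  ultimately obtain u where "is_arg_min d (\<lambda>v. v \<in> ?F) u"
    using ex_is_arg_min_if_finite by blast
  then have u: "u \<in> U" "r u = ?R" and u_min: "\<And>v. v \<in> U \<Longrightarrow> r v = ?R \<Longrightarrow> d u \<le> d v"
    by (auto simp: is_arg_min_linorder)
  (* The job u occupies the slot ?R, so the other jobs are released at Suc ?R at the earliest. *)
  let ?r = "\<lambda>v. max (r v) (Suc ?R)"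
  have hall: "card {v \<in> U - {u}. s \<le> ?r v \<and> d v \<le> t} \<le> t - s" for s t
  proof (cases "s \<le> Suc ?R")
    case True
    \<comment> \<open>Here \<open>s \<le> ?r v\<close> holds for every job, so the strongest bound
      needed is the one for the window that starts at \<open>Suc ?R\<close>.\<close>
    have "card {v \<in> U - {u}. d v \<le> t} \<le> t - Suc ?R"
    proof (cases "d u \<le> t")
      case True
      \<comment> \<open>The old condition at \<open>?R\<close> also counts \<open>u\<close>;
        removing \<open>u\<close> pays for the lost slot.\<close>
      have "{v \<in> U. ?R \<le> r v \<and> d v \<le> t} = insert u {v \<in> U - {u}. d v \<le> t}"
        using True u R_le by auto
      then have "card {v \<in> U. ?R \<le> r v \<and> d v \<le> t} = Suc (card {v \<in> U - {u}. d v \<le> t})"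
        using U by simp
      then show ?thesis using Suc.prems(2)[of ?R t] by linarith
    next
      case False
      \<comment> \<open>By the choice of \<open>u\<close>, all jobs released at \<open>?R\<close>
        are due after \<open>t\<close>, so those due by \<open>t\<close> are released later.\<close>
      have "{v \<in> U - {u}. d v \<le> t} \<subseteq> {v \<in> U. Suc ?R \<le> r v \<and> d v \<le> t}"
      proof safe
        fix v assume v: "v \<in> U" "d v \<le> t"
        with False u_min[of v] have "r v \<noteq> ?R" by auto
        with R_le[OF v(1)] show "Suc ?R \<le> r v" by linarith
      qed
      then have "card {v \<in> U - {u}. d v \<le> t} \<le> card {v \<in> U. Suc ?R \<le> r v \<and> d v \<le> t}"
        using U by (intro card_mono) auto
      then show ?thesis using Suc.prems(2)[of "Suc ?R" t] by linarith
    qed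
    moreover have "card {v \<in> U - {u}. s \<le> ?r v \<and> d v \<le> t} \<le> card {v \<in> U - {u}. d v \<le> t}"
      using U by (intro card_mono) auto
    ultimately show ?thesis using True by linarith
  next
    case False
    then have "card {v \<in> U - {u}. s \<le> ?r v \<and> d v \<le> t} \<le> card {v \<in> U. s \<le> r v \<and> d v \<le> t}"
      using U by (intro card_mono) auto
    then show ?thesis using Suc.prems(2)[of s t] by linarith
  qed
  have "n = card (U - {u})" using Suc.hyps(2) u U by simp
  from Suc.hyps(1)[OF this _ hall] U obtain f
    where f: "inj_on f (U - {u})" "\<And>v. v \<in> U - {u} \<Longrightarrow> ?r v \<le> f v \<and> f v < d v"
    by auto
  \<comment> \<open>Otherwise \<open>u\<close> would have to fit into the empty window from
    \<open>?R\<close> to \<open>?R\<close>.\<close>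
  have "?R < d u"
  proof (rule ccontr)
    assume "\<not> ?R < d u"
    then have "{u} \<subseteq> {v \<in> U. ?R \<le> r v \<and> d v \<le> ?R}" using u by simp
    then have "card {u} \<le> card {v \<in> U. ?R \<le> r v \<and> d v \<le> ?R}"
      using U by (intro card_mono) auto
    with Suc.prems(2)[of ?R ?R] show False by simp
  qed
  moreover have "?R \<noteq> f v" if "v \<in> U - {u}" for v using f(2)[OF that] by linarith
  then have "inj_on (f(u := ?R)) U"
    using f(1) by (fastforce simp: inj_on_def)
  moreover have "r v \<le> f v \<and> f v < d v" if "v \<in> U - {u}" for v using f(2)[OF that] by simp
  ultimately show ?case using u by (intro exI[of _ "f(u := ?R)"]) auto
qed

text \<open>Preemption allows each job \<open>j\<close> to be split into \<open>proc Q j\<close>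
  unit copies \<open>(j, k)\<close> that share its release date and deadline. Placing the copies
  injectively into slots gives the schedule.\<close>

lemma schedule_meeting_deadlines:
  assumes valid: "wft_valid Q"
    and hall: "\<And>s t. (\<Sum>j | j \<in> jobs Q \<and> s \<le> release Q j \<and> d j \<le> t. proc Q j) \<le> t - s"
  shows "\<exists>\<sigma>. feasible_schedule Q \<sigma> \<and> (\<forall>j\<in>jobs Q. completion_time \<sigma> j \<le> d j)"
proof -
  have fin: "finite (jobs Q)" and pos: "\<And>j. j \<in> jobs Q \<Longrightarrow> 0 < proc Q j"
    using valid by (auto simp: wft_valid_def)
  let ?U = "SIGMA j:jobs Q. {..<proc Q j}"
  have "card {v \<in> ?U. s \<le> release Q (fst v) \<and> d (fst v) \<le> t} \<le> t - s" for s t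
  proof -
    have "{v \<in> ?U. s \<le> release Q (fst v) \<and> d (fst v) \<le> t} =
        (SIGMA j:{j \<in> jobs Q. s \<le> release Q j \<and> d j \<le> t}. {..<proc Q j})"
      by auto
    then show ?thesis using hall[of s t] fin by simp
  qed
  then obtain f where inj: "inj_on f ?U"
    and f: "\<And>u. u \<in> ?U \<Longrightarrow> release Q (fst u) \<le> f u \<and> f u < d (fst u)"
    using unit_jobs_schedulable[of ?U "\<lambda>v. release Q (fst v)" "\<lambda>v. d (fst v)"] fin by auto
  define \<sigma> where
    "\<sigma> t = (if t \<in> f ` ?U then Some (fst (the_inv_into ?U f t)) else None)" for t
  have \<sigma>: "\<sigma> t = Some j \<longleftrightarrow> j \<in> jobs Q \<and> (\<exists>k<proc Q j. t = f (j, k))" for t j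
  proof
    assume "\<sigma> t = Some j"
    then show "j \<in> jobs Q \<and> (\<exists>k<proc Q j. t = f (j, k))"
      by (auto simp: \<sigma>_def the_inv_into_f_f[OF inj] split: if_splits)
  next
    assume "j \<in> jobs Q \<and> (\<exists>k<proc Q j. t = f (j, k))"
    then obtain k where jk: "(j, k) \<in> ?U" "t = f (j, k)" by auto
    then show "\<sigma> t = Some j"
      using the_inv_into_f_f[OF inj jk(1)] unfolding \<sigma>_def by (metis fst_conv imageI)
  qed
  have slots: "slots \<sigma> j = (\<lambda>k. f (j, k)) ` {..<proc Q j}" if "j \<in> jobs Q" for j
    using that by (auto simp: slots_def \<sigma>)
  have "card (slots \<sigma> j) = proc Q j" if "j \<in> jobs Q" for j
  proof -
    have "inj_on (\<lambda>k. f (j, k)) {..<proc Q j}"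
      using inj that by (auto simp: inj_on_def)
    then show ?thesis using slots[OF that] by (simp add: card_image)
  qed
  moreover have "release Q j \<le> t" if "\<sigma> t = Some j" for t j
    using that f by (auto simp: \<sigma>)
  ultimately have "feasible_schedule Q \<sigma>"
    by (auto simp: feasible_schedule_def slots \<sigma>)
  moreover have "completion_time \<sigma> j \<le> d j" if j: "j \<in> jobs Q" for j
  proof -
    have "Max (slots \<sigma> j) \<in> slots \<sigma> j"
      using pos[OF j] by (intro Max_in) (auto simp: slots[OF j])
    then obtain k where "(j, k) \<in> ?U" "Max (slots \<sigma> j) = f (j, k)"
      using j by (auto simp: slots[OF j])
    then show ?thesis using f[of "(j, k)"] by (simp add: completion_time_def)
  qed
  ultimately show ?thesis by blast
qed

section \<open>Completion times of feasible schedules as solutions of the program\<close>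

lemma feasible_slots_subset:
  assumes "feasible_schedule Q \<sigma>" and "j \<in> jobs Q"
  shows "slots \<sigma> j \<subseteq> {release Q j..<completion_time \<sigma> j}"
  using assms by (auto simp: feasible_schedule_def slots_def completion_time_def less_Suc_eq_le)

lemma release_less_completion_time:
  assumes "wft_valid Q" and "feasible_schedule Q \<sigma>" and "j \<in> jobs Q"
  shows "release Q j < completion_time \<sigma> j"
proof -
  have "card (slots \<sigma> j) > 0"
    using assms by (simp add: wft_valid_def feasible_schedule_def)
  then have "slots \<sigma> j \<noteq> {}" by auto
  then show ?thesis using feasible_slots_subset[OF assms(2,3)] by fastforce
qed

text \<open>The slots of these jobs are pairwise disjoint and all lie in
  \<open>{s..<t}\<close>.\<close>

lemma total_length_le_window:
  assumes valid: "wft_valid Q" and feas: "feasible_schedule Q \<sigma>"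
  shows "(\<Sum>j | j \<in> jobs Q \<and> s \<le> release Q j \<and> completion_time \<sigma> j \<le> t. proc Q j) \<le> t - s"
proof -
  let ?A = "{j \<in> jobs Q. s \<le> release Q j \<and> completion_time \<sigma> j \<le> t}"
  have fin: "finite ?A" using valid by (simp add: wft_valid_def)
  have "(\<Sum>j\<in>?A. proc Q j) = (\<Sum>j\<in>?A. card (slots \<sigma> j))"
    using feas by (auto simp: feasible_schedule_def)
  also have "\<dots> = card (\<Union>j\<in>?A. slots \<sigma> j)"
    using fin feas by (subst card_UN_disjoint) (auto simp: feasible_schedule_def slots_def)
  also have "\<dots> \<le> card {s..<t}"
    using feasible_slots_subset[OF feas] by (intro card_mono) fastforce+
  finally show ?thesis by simp
qed

lemma ip_feasible_completion_times:
  assumes valid: "wft_valid Q" and feas: "feasible_schedule Q \<sigma>"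
  shows "ip_feasible Q (\<lambda>j t. if t < completion_time \<sigma> j then 1 else 0)"
proof -
  have "(\<Sum>j\<in>jobs_in Q s t. int (proc Q j)) - (int t - int s)
      \<le> (\<Sum>j\<in>jobs_in Q s t. (if t < completion_time \<sigma> j then 1 else 0) * int (proc Q j))"
    if "s \<le> t" for s t
  proof -
    have fin: "finite (jobs_in Q s t)" using valid by (simp add: wft_valid_def jobs_in_def)
    let ?A = "{j \<in> jobs Q. s \<le> release Q j \<and> completion_time \<sigma> j \<le> t}"
    \<comment> \<open>A job completed by \<open>t\<close> is released before \<open>t\<close>, so
      the bound \<open>release Q j \<le> t\<close> in \<open>jobs_in\<close> comes for free.\<close>
    have A: "{j \<in> jobs_in Q s t. \<not> t < completion_time \<sigma> j} = ?A"
      using release_less_completion_time[OF valid feas] by (fastforce simp: jobs_in_def)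
    have "(\<Sum>j\<in>jobs_in Q s t. int (proc Q j)) =
        (\<Sum>j\<in>jobs_in Q s t. (if t < completion_time \<sigma> j then 1 else 0) * int (proc Q j))
        + (\<Sum>j\<in>jobs_in Q s t. if \<not> t < completion_time \<sigma> j then int (proc Q j) else 0)"
      unfolding sum.distrib[symmetric] by (intro sum.cong) auto
    also have "(\<Sum>j\<in>jobs_in Q s t. if \<not> t < completion_time \<sigma> j then int (proc Q j) else 0)
        = int (\<Sum>j\<in>?A. proc Q j)"
      using fin by (simp only: sum.inter_filter[symmetric] A of_nat_sum)
    also have "int (\<Sum>j\<in>?A. proc Q j) \<le> int (t - s)"
      using total_length_le_window[OF valid feas] by (simp only: of_nat_le_iff)
    finally show ?thesis using that by simp
  qed
  then show ?thesis by (auto simp: ip_feasible_def)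
qed

text \<open>The bound \<open>C_le\<close> keeps all times from release to completion within the
  range of the variables, so that the cost counts each of them.\<close>

lemma ip_cost_completion_times:
  assumes valid: "wft_valid Q" and feas: "feasible_schedule Q \<sigma>"
    and C_le: "\<And>j. j \<in> jobs Q \<Longrightarrow> completion_time \<sigma> j \<le> Suc (total_proc Q)"
  shows "ip_cost Q (\<lambda>j t. if t < completion_time \<sigma> j then 1 else 0) = weighted_flow_time Q \<sigma>"
  unfolding ip_cost_def weighted_flow_time_def
proof (intro sum.cong refl)
  fix j assume j: "j \<in> jobs Q"
  let ?I = "{release Q j..total_proc Q}" and ?C = "completion_time \<sigma> j"
  have "{t \<in> ?I. t < ?C} = {release Q j..<?C}" using C_le[OF j] by auto
  then have "(\<Sum>t\<in>?I. if t < ?C then 1 else 0 :: real) = real (?C - release Q j)"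
    by (simp flip: sum.inter_filter)
  also have "\<dots> = real ?C - real (release Q j)"
    using release_less_completion_time[OF valid feas j] by simp
  finally show "(\<Sum>t\<in>?I. weight Q j * real_of_int (if t < ?C then 1 else 0)) =
      weight Q j * (real ?C - real (release Q j))"
    unfolding sum_distrib_left[symmetric] if_distrib[of real_of_int] of_int_0 of_int_1
    by (rule arg_cong)
qed

section \<open>Deadlines read off from a solution of the program\<close>

text \<open>For feasible \<open>x\<close> and a release date within the horizon, this is the first
  \<open>t\<close> from the release date on with \<open>x j t = 0\<close>, or
  \<open>Suc (total_proc Q)\<close> if there is none. Counting the ones makes the cost a weighted
  sum of deadlines minus release dates directly.\<close>

definition deadline :: "'j wft_instance \<Rightarrow> ('j \<Rightarrow> nat \<Rightarrow> int) \<Rightarrow> 'j \<Rightarrow> nat" where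
  "deadline Q x j = release Q j + nat (\<Sum>t = release Q j..total_proc Q. x j t)"

context
  fixes Q :: "'j wft_instance" and x :: "'j \<Rightarrow> nat \<Rightarrow> int"
  assumes ip: "ip_feasible Q x"
begin

lemma ip_feasible_cases:
  assumes "j \<in> jobs Q" and "release Q j \<le> t" and "t \<le> total_proc Q"
  obtains "x j t = 0" | "x j t = 1"
proof -
  have "x j t \<in> {0, 1}" using ip assms unfolding ip_feasible_def by blast
  then show thesis using that by blast
qed

lemma ip_feasible_antimono:
  assumes "j \<in> jobs Q" and "release Q j \<le> u" and "u \<le> t" and "t \<le> total_proc Q"
  shows "x j t \<le> x j u"
  using assms(3,4)
proof (induction t rule: dec_induct)
  case (step m)
  have "x j (Suc m) \<le> x j (Suc m - 1)"
    using ip assms(1,2) step unfolding ip_feasible_def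
    by (meson Suc_le_eq le_imp_less_Suc le_trans)
  then show ?case using step by simp
qed simp

lemma sum_ip_variables_nonneg:
  assumes "j \<in> jobs Q"
  shows "0 \<le> (\<Sum>t = release Q j..total_proc Q. x j t)"
  using assms by (intro sum_nonneg) (auto elim: ip_feasible_cases)

lemma deadline_le_Suc_total_proc:
  assumes "j \<in> jobs Q" and "release Q j \<le> total_proc Q"
  shows "deadline Q x j \<le> Suc (total_proc Q)"
proof -
  have "x j t \<le> 1" if "t \<in> {release Q j..total_proc Q}" for t
    using assms(1) that by (auto elim: ip_feasible_cases)
  then have "(\<Sum>t = release Q j..total_proc Q. x j t) \<le> (\<Sum>t = release Q j..total_proc Q. 1)"
    by (intro sum_mono)
  then show ?thesis using assms(2) by (auto simp: deadline_def)
qed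

text \<open>If \<open>x j t\<close> were 1, monotonicity would make all variables from the release
  date up to \<open>t\<close> equal to 1, which pushes the deadline beyond \<open>t\<close>.\<close>

lemma ip_variable_zero_after_deadline:
  assumes j: "j \<in> jobs Q" and d: "deadline Q x j \<le> t" and t: "t \<le> total_proc Q"
  shows "x j t = 0"
proof (rule ccontr)
  assume nz: "x j t \<noteq> 0"
  have rt: "release Q j \<le> t" using d by (simp add: deadline_def)
  have "x j t = 1" using nz j rt t by (auto elim: ip_feasible_cases)
  then have "1 \<le> x j u" if "u \<in> {release Q j..t}" for u
    using that ip_feasible_antimono[of j u t] j t by auto
  then have "(\<Sum>u = release Q j..t. 1) \<le> (\<Sum>u = release Q j..t. x j u)"
    by (intro sum_mono)
  also have "\<dots> \<le> (\<Sum>u = release Q j..total_proc Q. x j u)"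
    using j t by (intro sum_mono2) (auto elim: ip_feasible_cases)
  finally show False using d rt by (simp add: deadline_def)
qed

lemma ip_cost_deadlines:
  "ip_cost Q x = (\<Sum>j\<in>jobs Q. weight Q j * (real (deadline Q x j) - real (release Q j)))"
  unfolding ip_cost_def
proof (intro sum.cong refl)
  fix j assume "j \<in> jobs Q"
  then have "real (deadline Q x j) - real (release Q j) =
      (\<Sum>t = release Q j..total_proc Q. real_of_int (x j t))"
    using sum_ip_variables_nonneg by (simp add: deadline_def flip: of_int_sum)
  then show "(\<Sum>t = release Q j..total_proc Q. weight Q j * real_of_int (x j t)) =
      weight Q j * (real (deadline Q x j) - real (release Q j))"
    by (simp add: sum_distrib_left)
qed

text \<open>The interval constraint bounds the sum of \<open>(1 - x j t) * proc Q j\<close> over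
  \<open>jobs_in Q s t\<close> by \<open>t - s\<close>. Jobs due by \<open>t\<close> contribute
  their full length, the others a nonnegative amount.\<close>

lemma total_length_le_deadline_window:
  assumes valid: "wft_valid Q" and "s \<le> t" and t: "t \<le> total_proc Q"
  shows "(\<Sum>j | j \<in> jobs Q \<and> s \<le> release Q j \<and> deadline Q x j \<le> t. proc Q j) \<le> t - s"
proof -
  let ?A = "{j \<in> jobs Q. s \<le> release Q j \<and> deadline Q x j \<le> t}" and ?J = "jobs_in Q s t"
  have "finite ?J" using valid by (simp add: wft_valid_def jobs_in_def)
  moreover have "?A \<subseteq> ?J" by (auto simp: jobs_in_def deadline_def)
  moreover have "0 \<le> (1 - x j t) * int (proc Q j)" if "j \<in> ?J" for j
    using that t by (auto simp: jobs_in_def elim: ip_feasible_cases)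
  ultimately have
    "(\<Sum>j\<in>?A. (1 - x j t) * int (proc Q j)) \<le> (\<Sum>j\<in>?J. (1 - x j t) * int (proc Q j))"
    by (intro sum_mono2) auto
  also have "\<dots> \<le> int t - int s"
  proof -
    have "(\<Sum>j\<in>?J. int (proc Q j)) - (int t - int s) \<le> (\<Sum>j\<in>?J. x j t * int (proc Q j))"
      using ip assms(2,3) unfolding ip_feasible_def by blast
    then show ?thesis by (simp add: left_diff_distrib sum_subtractf)
  qed
  also have "(\<Sum>j\<in>?A. (1 - x j t) * int (proc Q j)) = int (\<Sum>j\<in>?A. proc Q j)"
    using ip_variable_zero_after_deadline t by simp
  finally show ?thesis by linarith
qed

end

section \<open>From solutions of the program to schedules\<close>

theorem theorem2:
  fixes Q :: "'j wft_instance" and x :: "'j \<Rightarrow> nat \<Rightarrow> int"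
  assumes "wft_valid Q"
    and "horizon_suffices Q"
    and "ip_feasible Q x"
  shows "\<exists>\<sigma>. feasible_schedule Q \<sigma> \<and>
             weighted_flow_time Q \<sigma> \<le> ip_cost Q x \<and>
             (ip_optimal Q x \<longrightarrow> weighted_flow_time Q \<sigma> = ip_cost Q x)"
proof -
  note valid = assms(1) and ip = assms(3)
  let ?T = "total_proc Q" and ?d = "deadline Q x"
  \<comment> \<open>The schedule \<tau> need not meet the deadlines of \<open>x\<close>. It shows
    that all release dates are at most \<open>?T\<close>, and it bounds the total length in windows
    that end after \<open>?T\<close>.\<close>
  obtain \<tau> where \<tau>: "feasible_schedule Q \<tau>"
      "\<And>j. j \<in> jobs Q \<Longrightarrow> completion_time \<tau> j \<le> Suc ?T"
    using assms(2) by (auto simp: horizon_suffices_def)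
  have release_le: "release Q j \<le> ?T" if "j \<in> jobs Q" for j
    using release_less_completion_time[OF valid \<tau>(1) that] \<tau>(2)[OF that] by linarith
  have "(\<Sum>j | j \<in> jobs Q \<and> s \<le> release Q j \<and> ?d j \<le> t. proc Q j) \<le> t - s" for s t
  proof -
    let ?A = "{j \<in> jobs Q. s \<le> release Q j \<and> ?d j \<le> t}"
    consider "t < s" | "s \<le> t" "t \<le> ?T" | "?T < t" by linarith
    then show ?thesis
    proof cases
      case 1
      then have "?A = {}" by (auto simp: deadline_def)
      then show ?thesis by (simp only: sum.empty)
    next
      case 2
      then show ?thesis by (rule total_length_le_deadline_window[OF ip valid])
    next
      (* The program has no constraint for t > ?T: only the assumption on the horizon helps. *)
      case 3
      have "finite (jobs Q)" using valid by (simp add: wft_valid_def)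
      then have "(\<Sum>j\<in>?A. proc Q j)
          \<le> (\<Sum>j | j \<in> jobs Q \<and> s \<le> release Q j \<and> completion_time \<tau> j \<le> t. proc Q j)"
        using 3 \<tau>(2) by (intro sum_mono2) fastforce+
      also have "\<dots> \<le> t - s" by (rule total_length_le_window[OF valid \<tau>(1)])
      finally show ?thesis .
    qed
  qed
  from schedule_meeting_deadlines[OF valid this] obtain \<sigma>
    where \<sigma>: "feasible_schedule Q \<sigma>" and C_le: "\<And>j. j \<in> jobs Q \<Longrightarrow> completion_time \<sigma> j \<le> ?d j"
    by blast
  have le: "weighted_flow_time Q \<sigma> \<le> ip_cost Q x"
    unfolding weighted_flow_time_def ip_cost_deadlines[OF ip] using valid C_le
    by (intro sum_mono mult_left_mono) (auto simp: wft_valid_def)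
  \<comment> \<open>Since \<sigma> stays within the horizon, the solution defined by its completion
    times costs exactly its flow time and can be compared with an optimal \<open>x\<close>.\<close>
  have "completion_time \<sigma> j \<le> Suc ?T" if "j \<in> jobs Q" for j
    using C_le[OF that] deadline_le_Suc_total_proc[OF ip that release_le[OF that]] by linarith
  then have "ip_cost Q x \<le> weighted_flow_time Q \<sigma>" if "ip_optimal Q x"
    using that ip_feasible_completion_times[OF valid \<sigma>] ip_cost_completion_times[OF valid \<sigma>]
    unfolding ip_optimal_def by metis
  with \<sigma> le show ?thesis by (blast intro: antisym)
qed

end
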